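(* Let $\mathcal{P}=(P,\le)$ be a poset with $|P|\ge 5$. Then there are four (distinct) elements $x,y,z,w$ in $P$ such that $$\operatorname{ldim}(\mathcal{P})\le \operatorname{ldim}(\mathcal{P}-\{x,y,z,w\})+2.$$
   Context: Posets are finite and nonempty. $\mathcal{P}-S$ denotes the subposet induced on $P\setminus S$. A partial linear extension (ple) of a poset $\mathcal{P}=(P,\le)$ is a linear extension of a (nonempty) subposet of $\mathcal{P}$, i.e. a linear order on a nonempty subset $S\subseteq P$ that extends the order induced by $\mathcal{P}$ on $S$. A local realizer of $\mathcal{P}$ is a non-empty family $\mathcal{L}$ of ple's of $\mathcal{P}$ such that (i) if $x<y$ in $\mathcal{P}$, then some $L\in\mathcal{L}$ contains $x,y$ with $x<y$ in $L$; (ii) if $x$ and $y$ are incomparable in $\mathcal{P}$, then there are $L,L'\in\mathcal{L}$ with $x<y$ in $L$ and $x>y$ in $L'$. For $x\in P$, the frequency $\mu(x,\mathcal{L})$ is the number of ple's in $\mathcal{L}$ containing $x$, and $\mu(\mathcal{L})=\max_{x\in P}\mu(x,\mathcal{L})$. The local dimension is $\operatorname{ldim}(\mathcal{P})=\min_{\mathcal{L}}\mu(\mathcal{L})$, the minimum over all local realizers $\mathcal{L}$ of $\mathcal{P}$. (In particular a one-element poset has local dimension $1$.) *)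

theory Defs
  imports "HOL-Library.Multiset"
begin

text \<open>
  A finite poset is a carrier set \<open>P\<close> together with a reflexive order relation \<open>r\<close>, subject to
  \<open>finite P\<close> and \<open>partial_order_on P r\<close> (which entails \<open>r \<subseteq> P \<times> P\<close>).
  The subposet induced on \<open>Q \<subseteq> P\<close> has carrier \<open>Q\<close> and relation \<open>Restr r Q\<close>.
\<close>

definition strictly_below :: "'a rel \<Rightarrow> 'a \<Rightarrow> 'a \<Rightarrow> bool" where
  "strictly_below r x y \<longleftrightarrow> (x, y) \<in> r \<and> x \<noteq> y"

definition incomparable :: "'a rel \<Rightarrow> 'a \<Rightarrow> 'a \<Rightarrow> bool" where
  "incomparable r x y \<longleftrightarrow> (x, y) \<notin> r \<and> (y, x) \<notin> r"

text \<open>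
  Linear orders are reflexive relations, so the ground set of a partial linear extension \<open>L\<close>
  is determined by \<open>L\<close>: it is \<open>Field L\<close>.
\<close>

definition partial_linear_extension :: "'a set \<Rightarrow> 'a rel \<Rightarrow> 'a rel \<Rightarrow> bool" where
  "partial_linear_extension P r L \<longleftrightarrow>
     (\<exists>S. S \<noteq> {} \<and> S \<subseteq> P \<and> linear_order_on S L \<and> Restr r S \<subseteq> L)"

text \<open>
  A local realizer is a (finite) family; multisets permit repeated members, which are then counted
  with multiplicity in the frequency.
\<close>

definition local_realizer :: "'a set \<Rightarrow> 'a rel \<Rightarrow> 'a rel multiset \<Rightarrow> bool" where
  "local_realizer P r \<L> \<longleftrightarrow>
     \<L> \<noteq> {#} \<and>
     (\<forall>L\<in>#\<L>. partial_linear_extension P r L) \<and>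
     (\<forall>x\<in>P. \<forall>y\<in>P. strictly_below r x y \<longrightarrow> (\<exists>L\<in>#\<L>. strictly_below L x y)) \<and>
     (\<forall>x\<in>P. \<forall>y\<in>P. incomparable r x y \<longrightarrow>
        (\<exists>L\<in>#\<L>. \<exists>L'\<in>#\<L>. strictly_below L x y \<and> strictly_below L' y x))"

definition frequency :: "'a \<Rightarrow> 'a rel multiset \<Rightarrow> nat" where
  "frequency x \<L> = size {#L \<in># \<L>. x \<in> Field L#}"

definition max_frequency :: "'a set \<Rightarrow> 'a rel multiset \<Rightarrow> nat" where
  "max_frequency P \<L> = Max ((\<lambda>x. frequency x \<L>) ` P)"

definition ldim :: "'a set \<Rightarrow> 'a rel \<Rightarrow> nat" where
  "ldim P r = (LEAST k. \<exists>\<L>. local_realizer P r \<L> \<and> max_frequency P \<L> = k)"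

text \<open>
  Every finite nonempty poset has a local realizer, given by its one- and two-element partial
  linear extensions, so the minimum defining \<open>ldim\<close> is attained.
\<close>

lemma linear_order_on_Field_eq:
  assumes "linear_order_on S L"
  shows "Field L = S"
  using assms by (auto simp: order_on_defs refl_on_def Field_def)

lemma local_realizer_exists:
  assumes "finite P" "P \<noteq> {}" "partial_order_on P r"
  shows "\<exists>\<L>. local_realizer P r \<L>"
proof -
  define A where "A = (\<lambda>(x, y). {(x, x), (y, y), (x, y)}) ` {(x, y) \<in> P \<times> P. (y, x) \<in> r \<longrightarrow> x = y}"
  have fin: "finite A"
    unfolding A_def
    by (rule finite_imageI, rule finite_subset[of _ "P \<times> P"]) (use assms(1) in auto)
  have memI: "{(x, x), (y, y), (x, y)} \<in> A" if "x \<in> P" "y \<in> P" "(y, x) \<in> r \<longrightarrow> x = y" for x y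
    unfolding A_def by (rule image_eqI[of _ _ "(x, y)"]) (use that in simp_all)
  have ple: "partial_linear_extension P r L" if L: "L \<in> A" for L
  proof -
    obtain x y where xy: "x \<in> P" "y \<in> P" "(y, x) \<in> r \<longrightarrow> x = y" "L = {(x, x), (y, y), (x, y)}"
      using L unfolding A_def by auto
    have "trans L" "antisym L" "L \<subseteq> {x, y} \<times> {x, y}"
      unfolding xy(4) by (auto intro: transI antisymI)
    moreover have "refl_on {x, y} L" "total_on {x, y} L"
      unfolding xy(4) by (simp_all add: refl_on_def total_on_def)
    ultimately have "linear_order_on {x, y} L"
      unfolding order_on_defs by (intro conjI)
    moreover have "Restr r {x, y} \<subseteq> L"
      unfolding xy(4) using xy(3) by auto
    moreover have "{x, y} \<noteq> {}" "{x, y} \<subseteq> P"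
      using xy(1,2) by simp_all
    ultimately show ?thesis
      unfolding partial_linear_extension_def by (intro exI[of _ "{x, y}"] conjI)
  qed
  have anti: "x = y" if "(x, y) \<in> r" "(y, x) \<in> r" for x y
    using antisymD[OF partial_order_onD(3)[OF assms(3)] that] .
  have below: "\<exists>L\<in>A. strictly_below L x y"
    if "x \<in> P" "y \<in> P" "x \<noteq> y" "(y, x) \<notin> r" for x y
    by (rule bexI[OF _ memI[of x y]]) (use that in \<open>simp_all add: strictly_below_def\<close>)
  have refl: "(x, x) \<in> r" if "x \<in> P" for x
    using refl_onD[OF partial_order_onD(1)[OF assms(3)] that] .
  have "A \<noteq> {}" using memI assms(2) by blast
  moreover have "\<exists>L\<in>A. strictly_below L x y"
    if "x \<in> P" "y \<in> P" "strictly_below r x y" for x y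
    using below[of x y] anti[of x y] that by (auto simp: strictly_below_def)
  moreover have "(\<exists>L\<in>A. \<exists>L'\<in>A. strictly_below L x y \<and> strictly_below L' y x)"
    if "x \<in> P" "y \<in> P" "incomparable r x y" for x y
  proof -
    have "x \<noteq> y" "(x, y) \<notin> r" "(y, x) \<notin> r"
      using that refl by (auto simp: incomparable_def)
    then show ?thesis using below[of x y] below[of y x] that by blast
  qed
  ultimately have "local_realizer P r (mset_set A)"
    unfolding local_realizer_def
    using fin ple by (simp add: mset_set_empty_iff)
  then show ?thesis ..
qed

lemma ldim_attained:
  assumes "finite P" "P \<noteq> {}" "partial_order_on P r"
  obtains \<L> where "local_realizer P r \<L>" "max_frequency P \<L> = ldim P r"
  using LeastI_ex[of "\<lambda>k. \<exists>\<L>. local_realizer P r \<L> \<and> max_frequency P \<L> = k"]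
    local_realizer_exists[OF assms] unfolding ldim_def by blast

lemma ldim_le:
  assumes "local_realizer P r \<L>"
  shows "ldim P r \<le> max_frequency P \<L>"
  unfolding ldim_def using assms by (intro Least_le) blast

end

theory Submission
  imports Defs
begin

text \<open>
  Write \<open>t\<close> for the local dimension of what remains after deleting a set \<open>X\<close>. Partial linear
  extensions may be added freely as long as each element of \<open>P - X\<close> lies in at most two of them and
  their number is at most \<open>t + 2\<close>. One full linear extension puts \<open>X\<close> low; to put \<open>X\<close> high,
  \<open>P - X\<close> is split into parts on which the sets \<open>{v \<in> X. v < q}\<close> are nested, each part together
  with \<open>X\<close> carrying one further extension.

  If there is a three-element chain \<open>C\<close>, take \<open>X = C \<union> {x}\<close> with \<open>x\<close> minimal in \<open>P - C\<close>: two parts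
  suffice. Otherwise, unless \<open>P\<close> is an antichain, every element is minimal or maximal, and up to
  duality there are three minimal elements \<open>x, y, z\<close> and a maximal \<open>w > x\<close>. The subsets of
  \<open>{x, y, z}\<close> are covered by three nested families, which is affordable if \<open>t \<ge> 2\<close>; if \<open>t = 1\<close>, then \<open>P - X\<close> is a
  chain and needs only one part, leaving an extension of \<open>X\<close> alone to repair the order inside \<open>X\<close>.
\<close>

section \<open>Partial linear extensions given by rank functions\<close>

text \<open>Sorts \<open>S\<close> by \<open>f\<close>; ties are broken by \<open>h\<close>, in practice a linear extension of the whole poset.\<close>

definition rank_order :: "('a \<Rightarrow> nat) \<Rightarrow> 'a set \<Rightarrow> ('a \<Rightarrow> nat) \<Rightarrow> 'a rel" where
  "rank_order h S f = {(a, b). a \<in> S \<and> b \<in> S \<and> (f a < f b \<or> f a = f b \<and> h a \<le> h b)}"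

text \<open>The size of the down-set grows strictly along \<open>r\<close>. It is the leading digit
  in base \<open>n\<close>, and an arbitrary enumeration \<open>e\<close> with values below
  \<open>n\<close> separates equal sizes.\<close>

lemma linear_extension_exists:
  assumes "finite P" "partial_order_on P r"
  shows "\<exists>h :: 'a \<Rightarrow> nat. inj_on h P \<and> (\<forall>a b. strictly_below r a b \<longrightarrow> h a < h b)"
proof -
  obtain e :: "'a \<Rightarrow> nat" and n where e: "e ` P = {i. i < n}" "inj_on e P"
    using finite_imp_inj_to_nat_seg[OF assms(1)] by blast
  define c where "c a = card {b. (b, a) \<in> r}" for a
  define h where "h a = c a * n + e a" for a
  have sub: "r \<subseteq> P \<times> P" and tr: "trans r" and an: "antisym r" and rf: "refl_on P r"
    using assms(2) by (auto simp: order_on_defs)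
  have en: "e a < n" if "a \<in> P" for a using e(1) that by auto
  have less: "h a < h b" if "a \<in> P" "c a < c b" for a b
  proof -
    have "h a < Suc (c a) * n" using en[OF that(1)] by (simp add: h_def)
    also have "\<dots> \<le> c b * n" using that(2) by (intro mult_le_mono1) simp
    finally show ?thesis by (simp add: h_def)
  qed
  have "inj_on h P"
  proof (rule inj_onI)
    fix a b assume ab: "a \<in> P" "b \<in> P" "h a = h b"
    then have "c a = c b" using less[of a b] less[of b a] by (metis less_irrefl nat_neq_iff)
    then show "a = b" using ab e(2) by (auto simp: h_def inj_on_def)
  qed
  moreover have "h a < h b" if "strictly_below r a b" for a b
  proof -
    have ab: "(a, b) \<in> r" "a \<noteq> b" using that by (auto simp: strictly_below_def)
    then have P: "a \<in> P" "b \<in> P" using sub by auto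
    have "{u. (u, a) \<in> r} \<subset> {u. (u, b) \<in> r}"
      using ab tr an rf P by (auto dest: transD antisymD refl_onD)
    moreover have "finite {u. (u, b) \<in> r}"
      by (rule finite_subset[OF _ assms(1)]) (use sub in auto)
    ultimately have "c a < c b" unfolding c_def by (rule psubset_card_mono[rotated])
    then show ?thesis by (rule less[OF P(1)])
  qed
  ultimately show ?thesis by blast
qed

lemma linear_order_on_rank_order:
  assumes "inj_on h S"
  shows "linear_order_on S (rank_order h S f)"
proof -
  have "trans (rank_order h S f)" by (rule transI) (auto simp: rank_order_def)
  moreover have "antisym (rank_order h S f)"
    using assms by (intro antisymI) (auto simp: rank_order_def inj_on_def)
  ultimately show ?thesis
    unfolding order_on_defs by (auto simp: rank_order_def refl_on_def total_on_def)
qed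

lemma Field_rank_order: "Field (rank_order h S f) = S"
  by (auto simp: rank_order_def Field_def)

lemma partial_linear_extension_strictly_below:
  assumes "partial_linear_extension P r L" "strictly_below r a b" "a \<in> Field L" "b \<in> Field L"
  shows "strictly_below L a b"
  using assms linear_order_on_Field_eq
  unfolding partial_linear_extension_def strictly_below_def by blast

text \<open>Weak monotonicity suffices, since the tie-breaker already respects \<open>r\<close>.
  Many elements may thus share one rank.\<close>

definition rank_mono :: "'a rel \<Rightarrow> 'a set \<Rightarrow> ('a \<Rightarrow> nat) \<Rightarrow> bool" where
  "rank_mono r S f \<longleftrightarrow> (\<forall>a\<in>S. \<forall>b\<in>S. (a, b) \<in> r \<longrightarrow> f a \<le> f b)"

lemma rank_monoI:
  assumes "\<And>a b. a \<in> S \<Longrightarrow> b \<in> S \<Longrightarrow> (a, b) \<in> r \<Longrightarrow> a \<noteq> b \<Longrightarrow> f a \<le> f b"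
  shows "rank_mono r S f"
  unfolding rank_mono_def using assms by (metis order_refl)

lemma partial_linear_extension_rank_order:
  assumes "inj_on h P" "\<And>a b. strictly_below r a b \<Longrightarrow> h a < h b"
    and "S \<subseteq> P" "S \<noteq> {}" "rank_mono r S f"
  shows "partial_linear_extension P r (rank_order h S f)"
proof -
  have "Restr r S \<subseteq> rank_order h S f"
  proof clarify
    fix a b assume ab: "(a, b) \<in> r" "a \<in> S" "b \<in> S"
    then have "f a \<le> f b" using assms(5) by (auto simp: rank_mono_def)
    moreover have "h a \<le> h b"
      using assms(2)[of a b] ab(1) by (cases "a = b") (auto simp: strictly_below_def)
    ultimately show "(a, b) \<in> rank_order h S f" using ab by (auto simp: rank_order_def)
  qed
  then show ?thesis
    unfolding partial_linear_extension_def
    using linear_order_on_rank_order[OF inj_on_subset[OF assms(1,3)]] assms(3,4) by blast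
qed

section \<open>Extending a local realizer across a removed set\<close>

lemma frequency_rank_orders:
  "frequency x (mset (map (\<lambda>(S, f). rank_order h S f) F)) = length (filter (\<lambda>(S, f). x \<in> S) F)"
  by (induction F) (auto simp: frequency_def Field_rank_order)

lemma frequency_union: "frequency x (A + B) = frequency x A + frequency x B"
  by (simp add: frequency_def)

lemma frequency_le_max_frequency:
  assumes "finite P" "x \<in> P"
  shows "frequency x \<L> \<le> max_frequency P \<L>"
  unfolding max_frequency_def using assms by (intro Max_ge) auto

lemma max_frequency_le:
  assumes "finite P" "P \<noteq> {}" "\<And>x. x \<in> P \<Longrightarrow> frequency x \<L> \<le> k"
  shows "max_frequency P \<L> \<le> k"
  unfolding max_frequency_def using assms by (subst Max_le_iff) auto

lemma partial_order_on_Restr: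
  assumes "partial_order_on P r" "Q \<subseteq> P"
  shows "partial_order_on Q (Restr r Q)"
proof -
  have "trans (Restr r Q)" "antisym (Restr r Q)"
    using assms(1) unfolding order_on_defs trans_def antisym_def by blast+
  then show ?thesis using assms unfolding order_on_defs refl_on_def by blast
qed

lemma partial_linear_extension_Restr:
  assumes "partial_linear_extension Q (Restr r Q) L" "Q \<subseteq> P"
  shows "partial_linear_extension P r L" "Field L \<subseteq> Q"
proof -
  obtain S where S: "S \<noteq> {}" "S \<subseteq> Q" "linear_order_on S L" "Restr (Restr r Q) S \<subseteq> L"
    using assms(1) unfolding partial_linear_extension_def by blast
  have "Restr (Restr r Q) S = Restr r S" using S(2) by blast
  then show "partial_linear_extension P r L"
    using S assms(2) unfolding partial_linear_extension_def by (intro exI[of _ S]) auto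
  show "Field L \<subseteq> Q" using linear_order_on_Field_eq[OF S(3)] S(2) by simp
qed

text \<open>The extensions listed in \<open>F\<close> join an optimal local realizer of
  \<open>P - X\<close>, which already settles all pairs inside \<open>P - X\<close>. An element of
  \<open>P - X\<close> gains at most 2 in frequency, and an element of \<open>X\<close> occurs only
  in \<open>F\<close>. In \<open>cover\<close>, a pair in \<open>r\<close> only has to occur
  together somewhere, as every partial linear extension then orders it correctly.\<close>

lemma ldim_removal:
  fixes P :: "'a set"
  assumes fin: "finite P" and po: "partial_order_on P r"
    and ne: "P - X \<noteq> {}"
    and F: "\<And>S f. (S, f) \<in> set F \<Longrightarrow> S \<subseteq> P \<and> S \<noteq> {} \<and> rank_mono r S f"
    and cover: "\<And>a b. a \<in> P \<Longrightarrow> b \<in> P \<Longrightarrow> a \<in> X \<or> b \<in> X \<Longrightarrow> a \<noteq> b \<Longrightarrow> (b, a) \<notin> r \<Longrightarrow>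
      \<exists>(S, f)\<in>set F. a \<in> S \<and> b \<in> S \<and> (f a < f b \<or> (a, b) \<in> r)"
    and freq: "\<And>q. q \<in> P - X \<Longrightarrow> length (filter (\<lambda>(S, f). q \<in> S) F) \<le> 2"
    and len: "length F \<le> ldim (P - X) (Restr r (P - X)) + 2"
  shows "ldim P r \<le> ldim (P - X) (Restr r (P - X)) + 2"
proof -
  define Q where "Q = P - X"
  have Q: "Q \<subseteq> P" "finite Q" "Q \<noteq> {}" using fin ne by (auto simp: Q_def)
  obtain \<L> where \<L>: "local_realizer Q (Restr r Q) \<L>" "max_frequency Q \<L> = ldim Q (Restr r Q)"
    using ldim_attained[OF Q(2,3) partial_order_on_Restr[OF po Q(1)]] .
  obtain h :: "'a \<Rightarrow> nat" where h: "inj_on h P" "\<And>a b. strictly_below r a b \<Longrightarrow> h a < h b"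
    using linear_extension_exists[OF fin po] by blast
  define N where "N = mset (map (\<lambda>(S, f). rank_order h S f) F)"
  have pleL: "partial_linear_extension P r L" "Field L \<subseteq> Q" if "L \<in># \<L>" for L
    using \<L>(1) that Q(1) partial_linear_extension_Restr unfolding local_realizer_def by blast+
  have pleN: "partial_linear_extension P r L" if "L \<in># N" for L
  proof -
    obtain S f where "(S, f) \<in> set F" "L = rank_order h S f" using \<open>L \<in># N\<close> by (auto simp: N_def)
    then show ?thesis using partial_linear_extension_rank_order[OF h] F by blast
  qed
  \<comment> \<open>The hypothesis covers both \<open>a\<close> below \<open>b\<close> and
    \<open>a\<close> incomparable to \<open>b\<close>. One use gives the comparable clause of a
    local realizer, two uses with \<open>a\<close> and \<open>b\<close> exchanged the incomparable
    one.\<close>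
  have below: "\<exists>L\<in>#\<L> + N. strictly_below L a b"
    if ab: "a \<in> P" "b \<in> P" "a \<noteq> b" "(b, a) \<notin> r" for a b
  proof (cases "a \<in> X \<or> b \<in> X")
    case True
    then obtain S f where Sf: "(S, f) \<in> set F" "a \<in> S" "b \<in> S" "f a < f b \<or> (a, b) \<in> r"
      using cover[OF ab(1,2) _ ab(3,4)] by blast
    have L: "rank_order h S f \<in># N" using Sf(1) by (auto simp: N_def)
    have "strictly_below (rank_order h S f) a b"
    proof (cases "(a, b) \<in> r")
      case True
      show ?thesis
        by (rule partial_linear_extension_strictly_below[OF pleN[OF L]])
          (use True ab Sf in \<open>auto simp: Field_rank_order strictly_below_def\<close>)
    next
      case False
      then show ?thesis using Sf ab by (auto simp: rank_order_def strictly_below_def)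
    qed
    then show ?thesis using L by auto
  next
    case False
    then have abQ: "a \<in> Q" "b \<in> Q" using ab by (auto simp: Q_def)
    have "strictly_below (Restr r Q) a b \<or> incomparable (Restr r Q) a b"
      using ab by (auto simp: strictly_below_def incomparable_def)
    then show ?thesis
      using \<L>(1) abQ unfolding local_realizer_def by (meson union_iff)
  qed
  have "local_realizer P r (\<L> + N)"
    unfolding local_realizer_def
  proof (intro conjI ballI impI)
    show "\<L> + N \<noteq> {#}" using \<L>(1) by (auto simp: local_realizer_def)
    show "partial_linear_extension P r L" if "L \<in># \<L> + N" for L
      using that pleL(1) pleN by auto
    fix a b assume P: "a \<in> P" "b \<in> P"
    show "\<exists>L\<in>#\<L> + N. strictly_below L a b" if "strictly_below r a b"
    proof (rule below[OF P])
      show "a \<noteq> b" using that by (simp add: strictly_below_def)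
      show "(b, a) \<notin> r"
        using that antisymD[OF partial_order_onD(3)[OF po]] by (auto simp: strictly_below_def)
    qed
    show "\<exists>L\<in>#\<L> + N. \<exists>L'\<in>#\<L> + N. strictly_below L a b \<and> strictly_below L' b a"
      if "incomparable r a b"
    proof -
      have "a \<noteq> b" "(a, b) \<notin> r" "(b, a) \<notin> r"
        using that refl_onD[OF partial_order_onD(1)[OF po] P(1)] by (auto simp: incomparable_def)
      then show ?thesis using below[OF P] below[OF P(2,1)] by blast
    qed
  qed
  then have "ldim P r \<le> max_frequency P (\<L> + N)" by (rule ldim_le)
  also have "\<dots> \<le> ldim Q (Restr r Q) + 2"
  proof (rule max_frequency_le[OF fin])
    show "P \<noteq> {}" using Q by auto
    fix p assume p: "p \<in> P"
    have fN: "frequency p N = length (filter (\<lambda>(S, f). p \<in> S) F)"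
      by (simp only: N_def frequency_rank_orders)
    show "frequency p (\<L> + N) \<le> ldim Q (Restr r Q) + 2"
    proof (cases "p \<in> Q")
      case True
      then show ?thesis
        using freq[of p] frequency_le_max_frequency[OF Q(2) True, of \<L>] fN \<L>(2)
        by (simp add: frequency_union Q_def)
    next
      case False
      then have "frequency p \<L> = 0"
        using pleL(2) by (auto simp: frequency_def filter_mset_eq_mempty_iff)
      moreover have "frequency p N \<le> length F" unfolding fN by (rule length_filter_le)
      ultimately show ?thesis using len by (simp add: frequency_union Q_def)
    qed
  qed
  finally show ?thesis by (simp add: Q_def)
qed

section \<open>Small local dimension and duality\<close>

lemma ldim_ge_1:
  assumes "finite P" "P \<noteq> {}" "partial_order_on P r"
  shows "ldim P r \<ge> 1"
proof -
  obtain \<L> where \<L>: "local_realizer P r \<L>" "max_frequency P \<L> = ldim P r"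
    using ldim_attained[OF assms] .
  then obtain L where L: "L \<in># \<L>" "partial_linear_extension P r L"
    unfolding local_realizer_def by blast
  then obtain S where "S \<noteq> {}" "S \<subseteq> P" "Field L = S"
    using linear_order_on_Field_eq[of _ L] unfolding partial_linear_extension_def by blast
  then obtain p where p: "p \<in> P" "p \<in> Field L" by blast
  have "\<L> = add_mset L (\<L> - {#L#})" using L(1) by simp
  then have "frequency p \<L> = Suc (frequency p (\<L> - {#L#}))"
    using p(2) unfolding frequency_def by (metis filter_mset_add_mset size_add_mset)
  then show ?thesis using frequency_le_max_frequency[OF assms(1) p(1), of \<L>] \<L>(2) by simp
qed

text \<open>An incomparable pair is ordered both ways, by two members that differ by antisymmetry,
  so each of its elements has frequency at least 2.\<close>

lemma comparable_if_ldim_le_1: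
  assumes "finite P" "partial_order_on P r" "ldim P r \<le> 1" "a \<in> P" "b \<in> P"
  shows "(a, b) \<in> r \<or> (b, a) \<in> r"
proof (rule ccontr)
  assume "\<not> ?thesis"
  then have inc: "incomparable r a b" by (simp add: incomparable_def)
  have ne: "P \<noteq> {}" using assms by auto
  obtain \<L> where \<L>: "local_realizer P r \<L>" "max_frequency P \<L> = ldim P r"
    using ldim_attained[OF assms(1) ne assms(2)] .
  obtain L L' where L: "L \<in># \<L>" "L' \<in># \<L>" "strictly_below L a b" "strictly_below L' b a"
    using \<L>(1) inc assms(4,5) unfolding local_realizer_def by blast
  have "antisym L"
    using L(1) \<L>(1) unfolding local_realizer_def partial_linear_extension_def order_on_defs by blast
  then have "L \<noteq> L'"
    using L(3,4) by (auto simp: strictly_below_def dest: antisymD)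
  obtain A where A: "\<L> = add_mset L A" using multi_member_split[OF L(1)] by blast
  then have L'A: "L' \<in># A" using L(2) \<open>L \<noteq> L'\<close> by auto
  obtain B where B: "A = add_mset L' B" using multi_member_split[OF L'A] by blast
  have "a \<in> Field L" "a \<in> Field L'"
    using L(3,4) by (auto simp: strictly_below_def Field_def)
  then have "2 \<le> frequency a \<L>" by (simp add: A B frequency_def)
  then show False
    using frequency_le_max_frequency[OF assms(1,4), of \<L>] \<L>(2) assms(3) by simp
qed

text \<open>Reversing every member of a local realizer gives one of the dual poset with the same
  frequencies.\<close>

lemma ldim_converse_le:
  assumes "finite P" "P \<noteq> {}" "partial_order_on P r"
  shows "ldim P (r\<inverse>) \<le> ldim P r"
proof -
  obtain \<L> where \<L>: "local_realizer P r \<L>" "max_frequency P \<L> = ldim P r"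
    using ldim_attained[OF assms] .
  have ple: "partial_linear_extension P (r\<inverse>) (L\<inverse>)" if "partial_linear_extension P r L" for L
    using that unfolding partial_linear_extension_def
    by fastforce
  have sb: "strictly_below (s\<inverse>) a b \<longleftrightarrow> strictly_below s b a" for s :: "'a rel" and a b
    by (auto simp: strictly_below_def)
  have inc: "incomparable (r\<inverse>) a b \<longleftrightarrow> incomparable r b a" for a b
    by (auto simp: incomparable_def)
  have "local_realizer P (r\<inverse>) (image_mset converse \<L>)"
    using \<L>(1) ple unfolding local_realizer_def by (simp add: sb inc)
  moreover have "frequency x (image_mset converse \<L>) = frequency x \<L>" for x
    by (simp add: frequency_def filter_mset_image_mset)
  ultimately show ?thesis using ldim_le \<L>(2) by (fastforce simp: max_frequency_def)
qed

lemma ldim_converse: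
  assumes "finite P" "P \<noteq> {}" "partial_order_on P r"
  shows "ldim P (r\<inverse>) = ldim P r"
  using ldim_converse_le[OF assms] ldim_converse_le[OF assms(1,2), of "r\<inverse>"] assms(3) by simp

section \<open>Removing a chain and one further point\<close>

text \<open>For a chain \<open>C\<close>, this is the position of \<open>p\<close> if
  \<open>p\<close> is in \<open>C\<close>; otherwise it is the lowest gap of \<open>C\<close> into
  which a linear extension can put \<open>p\<close>, and \<open>down_rank\<close> is the
  highest.\<close>

definition up_rank :: "'a rel \<Rightarrow> 'a set \<Rightarrow> 'a \<Rightarrow> nat" where
  "up_rank r C p = card {c \<in> C. (c, p) \<in> r}"

definition down_rank :: "'a rel \<Rightarrow> 'a set \<Rightarrow> 'a \<Rightarrow> nat" where
  "down_rank r C p = card {c \<in> C. (p, c) \<notin> r}"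

context
  fixes P :: "'a set" and r :: "'a rel" and C :: "'a set"
  assumes po: "partial_order_on P r" and C: "C \<subseteq> P" "finite C"
    and chain: "\<forall>a\<in>C. \<forall>b\<in>C. (a, b) \<in> r \<or> (b, a) \<in> r"
begin

lemma up_rank_mono: "(a, b) \<in> r \<Longrightarrow> up_rank r C a \<le> up_rank r C b"
  unfolding up_rank_def using C partial_order_onD(2)[OF po]
  by (intro card_mono) (auto dest: transD)

lemma down_rank_mono: "(a, b) \<in> r \<Longrightarrow> down_rank r C a \<le> down_rank r C b"
  unfolding down_rank_def using C partial_order_onD(2)[OF po]
  by (intro card_mono) (auto dest: transD)

text \<open>A chain member below \<open>a\<close> and above \<open>b\<close> would give
  \<open>b\<close> below \<open>a\<close>. Hence placing \<open>a\<close> low and \<open>b\<close>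
  high brings \<open>a\<close> before \<open>b\<close>, provided that low precedes high within a
  gap.\<close>

lemma up_rank_le_down_rank: "(b, a) \<notin> r \<Longrightarrow> up_rank r C a \<le> down_rank r C b"
  unfolding up_rank_def down_rank_def using C partial_order_onD(2)[OF po]
  by (intro card_mono) (auto dest: transD)

text \<open>A member of \<open>C\<close> below \<open>p\<close> cannot be above \<open>c\<close>, so
  it is below \<open>c\<close>; and \<open>c\<close> itself counts only on the right. Thus
  \<open>p\<close>, placed low, precedes every chain member not below it.\<close>

lemma up_rank_less:
  assumes "c \<in> C" "p \<in> P" "(c, p) \<notin> r"
  shows "up_rank r C p < up_rank r C c"
  unfolding up_rank_def
proof (rule psubset_card_mono)
  have "(c, c) \<in> r" using assms(1) C refl_onD[OF partial_order_onD(1)[OF po]] by auto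
  moreover have "{d \<in> C. (d, p) \<in> r} \<subseteq> {d \<in> C. (d, c) \<in> r}"
    using chain assms(1,3) partial_order_onD(2)[OF po] by (blast dest: transD)
  ultimately show "{d \<in> C. (d, p) \<in> r} \<subset> {d \<in> C. (d, c) \<in> r}" using assms by blast
qed (use C in simp)

lemma down_rank_less:
  assumes "c \<in> C" "(p, c) \<in> r"
  shows "down_rank r C p < up_rank r C c"
  unfolding up_rank_def down_rank_def
proof (rule psubset_card_mono)
  have "(c, c) \<in> r" using assms(1) C refl_onD[OF partial_order_onD(1)[OF po]] by auto
  moreover have "{d \<in> C. (p, d) \<notin> r} \<subseteq> {d \<in> C. (d, c) \<in> r}"
    using chain assms partial_order_onD(2)[OF po] by (blast dest: transD)
  ultimately show "{d \<in> C. (p, d) \<notin> r} \<subset> {d \<in> C. (d, c) \<in> r}" using assms by blast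
qed (use C in simp)

text \<open>\<open>f\<close> keeps \<open>x\<close> low and lifts all outside elements as high as
  \<open>C\<close> allows. For the opposite orders the outside elements go low: those not above
  \<open>x\<close> in \<open>g\<close>, where \<open>x\<close> goes high, and those above
  \<open>x\<close> in \<open>h\<close>. An outside element thus lies in \<open>f\<close> and in one
  of \<open>g\<close>, \<open>h\<close>.\<close>

lemma ldim_removal_chain_and_point:
  assumes fin: "finite P" and x: "x \<in> P" "x \<notin> C"
    and min: "\<And>p. (p, x) \<in> r \<Longrightarrow> p \<in> insert x C"
    and ne: "P - insert x C \<noteq> {}"
  shows "ldim P r \<le> ldim (P - insert x C) (Restr r (P - insert x C)) + 2"
proof -
  let ?u = "up_rank r C" and ?d = "down_rank r C"
  let ?S = "{p \<in> P. p \<in> insert x C \<or> (x, p) \<notin> r}"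
    and ?T = "{p \<in> P. p \<in> insert x C \<or> (x, p) \<in> r}"
  \<comment> \<open>Multiples of 3 belong to the chain. In the gap after a chain member, remainder 1
    is the slot for elements placed low and remainder 2 the slot for elements placed high.\<close>
  define f where "f p = (if p \<in> C then 3 * ?u p else if p = x then 3 * ?u p + 1 else 3 * ?d p + 2)" for p
  define g where "g p = (if p \<in> C then 3 * ?u p else if p = x then 3 * ?d p + 2 else 3 * ?u p + 1)" for p
  define h where "h p = (if p \<in> C then 3 * ?u p else 3 * ?u p + 1)" for p
  have anti: "(b, a) \<notin> r" if "(a, b) \<in> r" "a \<noteq> b" for a b
    using antisymD[OF partial_order_onD(3)[OF po]] that by blast
  have f: "rank_mono r P f"
  proof (rule rank_monoI)
    fix a b assume ab: "a \<in> P" "b \<in> P" "(a, b) \<in> r" "a \<noteq> b"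
    show "f a \<le> f b"
      using ab anti[OF ab(3,4)] min[of a] up_rank_mono[of a b] down_rank_mono[of a b]
        up_rank_le_down_rank[of b a] up_rank_less[of b a] down_rank_less[of b a] x(2)
      by (auto simp: f_def)
  qed
  have g: "rank_mono r ?S g"
  proof (rule rank_monoI)
    fix a b assume ab: "a \<in> ?S" "b \<in> ?S" "(a, b) \<in> r" "a \<noteq> b"
    show "g a \<le> g b"
      using ab anti[OF ab(3,4)] up_rank_mono[of a b] up_rank_le_down_rank[of b a]
        up_rank_less[of b a] down_rank_less[of b a] x(2)
      by (auto simp: g_def)
  qed
  have h: "rank_mono r ?T h"
  proof (rule rank_monoI)
    fix a b assume ab: "a \<in> ?T" "b \<in> ?T" "(a, b) \<in> r" "a \<noteq> b"
    show "h a \<le> h b"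
      using ab anti[OF ab(3,4)] up_rank_mono[of a b] up_rank_less[of b a]
      by (auto simp: h_def)
  qed
  let ?F = "[(P, f), (?S, g), (?T, h)]"
  show ?thesis
  proof (rule ldim_removal[OF fin po ne, of ?F])
    show "S \<subseteq> P \<and> S \<noteq> {} \<and> rank_mono r S k" if "(S, k) \<in> set ?F" for S k
      using that f g h x(1) by auto
    show "\<exists>(S, k)\<in>set ?F. a \<in> S \<and> b \<in> S \<and> (k a < k b \<or> (a, b) \<in> r)"
      if ab: "a \<in> P" "b \<in> P" "a \<in> insert x C \<or> b \<in> insert x C" "a \<noteq> b" "(b, a) \<notin> r" for a b
    \<comment> \<open>These pairs are served by \<open>f\<close>. What remains is an outside element
      before a chain member, by \<open>g\<close> or \<open>h\<close>, or some element before
      \<open>x\<close>, by \<open>g\<close>.\<close>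
    proof (cases "(a, b) \<in> r \<or> a \<in> insert x C \<and> b \<notin> C \<and> b \<noteq> x \<or> a = x")
      case True
      then have "f a < f b \<or> (a, b) \<in> r"
        using ab up_rank_le_down_rank[of b a] up_rank_less[of b a] x(2) by (auto simp: f_def)
      then show ?thesis using ab by auto
    next
      case False
      then have "a \<notin> C \<and> b \<in> C \<or> b = x" using ab chain by auto
      then have "(a \<in> ?T \<longrightarrow> b \<in> C \<longrightarrow> h a < h b) \<and> (a \<in> ?S \<longrightarrow> g a < g b)"
        using ab False up_rank_le_down_rank[of b a] up_rank_less[of b a] x(2)
        by (auto simp: g_def h_def)
      then show ?thesis using ab False by auto
    qed
    show "length (filter (\<lambda>(S, k). q \<in> S) ?F) \<le> 2" if "q \<in> P - insert x C" for q
      using that by auto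
    have "finite (P - insert x C)" using fin by simp
    from ldim_ge_1[OF this ne partial_order_on_Restr[OF po]]
    show "length ?F \<le> ldim (P - insert x C) (Restr r (P - insert x C)) + 2" by auto
  qed
qed

end

section \<open>Antichains\<close>

text \<open>An enumeration and its reverse order all pairs both ways. Since \<open>e p < n\<close>
  on \<open>P\<close>, the truncated subtraction \<open>n - e p\<close> is a strict
  reversal.\<close>

lemma ldim_removal_antichain:
  fixes P :: "'a set"
  assumes fin: "finite P" and po: "partial_order_on P r" and ne: "P - X \<noteq> {}"
    and anti: "\<And>a b. (a, b) \<in> r \<Longrightarrow> a = b"
  shows "ldim P r \<le> ldim (P - X) (Restr r (P - X)) + 2"
proof -
  obtain e :: "'a \<Rightarrow> nat" and n where e: "e ` P = {i. i < n}" "inj_on e P"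
    using finite_imp_inj_to_nat_seg[OF fin] by blast
  have en: "e p < n" if "p \<in> P" for p using e(1) that by blast
  show ?thesis
  proof (rule ldim_removal[OF fin po ne, of "[(P, e), (P, \<lambda>p. n - e p)]"])
    show "S \<subseteq> P \<and> S \<noteq> {} \<and> rank_mono r S k" if "(S, k) \<in> set [(P, e), (P, \<lambda>p. n - e p)]" for S k
    proof -
      have "rank_mono r P k" by (rule rank_monoI) (use anti in blast)
      then show ?thesis using that ne by auto
    qed
    show "\<exists>(S, k)\<in>set [(P, e), (P, \<lambda>p. n - e p)]. a \<in> S \<and> b \<in> S \<and> (k a < k b \<or> (a, b) \<in> r)"
      if "a \<in> P" "b \<in> P" "a \<noteq> b" for a b
    proof -
      have "e a \<noteq> e b" using that inj_onD[OF e(2)] by blast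
      then have "e a < e b \<or> n - e a < n - e b" using en[OF that(1)] by linarith
      then show ?thesis using that by auto
    qed
    show "length (filter (\<lambda>(S, k). q \<in> S) [(P, e), (P, \<lambda>p. n - e p)]) \<le> 2" for q
      by simp
  qed simp
qed

section \<open>Removing three minimal elements and one maximal element\<close>

context
  fixes P :: "'a set" and r :: "'a rel" and x y z w :: 'a
  assumes fin: "finite P" and po: "partial_order_on P r"
    and mem: "x \<in> P" "y \<in> P" "z \<in> P" "w \<in> P" and dist: "distinct [x, y, z, w]"
    and min: "\<And>p. (p, x) \<in> r \<Longrightarrow> p = x" "\<And>p. (p, y) \<in> r \<Longrightarrow> p = y" "\<And>p. (p, z) \<in> r \<Longrightarrow> p = z"
    and max: "\<And>p. (w, p) \<in> r \<Longrightarrow> p = w"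
    and xw: "(x, w) \<in> r"
    and ne: "P - {x, y, z, w} \<noteq> {}"
begin

lemma not_below: "(a, b) \<in> r \<Longrightarrow> a \<noteq> b \<Longrightarrow> b \<noteq> x \<and> b \<noteq> y \<and> b \<noteq> z \<and> a \<noteq> w"
  using min max by blast

text \<open>Traces in \<open>{x, y, z}\<close> grow along \<open>r\<close>, and being below
  \<open>w\<close> passes downwards; this is the transitivity behind the ranks below.\<close>

lemma trans_ab:
  assumes "(a, b) \<in> r"
  shows "((x, a) \<in> r \<longrightarrow> (x, b) \<in> r) \<and> ((y, a) \<in> r \<longrightarrow> (y, b) \<in> r) \<and> ((z, a) \<in> r \<longrightarrow> (z, b) \<in> r)
    \<and> ((b, w) \<in> r \<longrightarrow> (a, w) \<in> r)"
  using assms transD[OF partial_order_onD(2)[OF po]] by blast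

lemma ldim_removal_wide:
  assumes t: "ldim (P - {x, y, z, w}) (Restr r (P - {x, y, z, w})) \<ge> 2"
  shows "ldim P r \<le> ldim (P - {x, y, z, w}) (Restr r (P - {x, y, z, w})) + 2"
proof -
  let ?X = "{x, y, z, w}"
  define d :: "'a \<Rightarrow> nat" where "d p = (if p = x then 0 else if p = y then 1 else if p = z then 2
    else if p = w then 4 else if (p, w) \<in> r then 3 else 5)" for p
  \<comment> \<open>In \<open>f\<close>, \<open>g\<close> and \<open>h\<close>, on their respective
    parts, outside elements take even ranks just above the last member of their trace. So they
    precede every element of \<open>X\<close> that is not below them, in particular
    \<open>w\<close>.\<close>
  define f :: "'a \<Rightarrow> nat" where "f p = (if p = x then 1 else if p = y then 3 else if p = w then 6
    else if p = z then (if (z, w) \<in> r then 5 else 7)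
    else if (y, p) \<in> r then 4 else if (x, p) \<in> r then 2 else 0)" for p
  define g :: "'a \<Rightarrow> nat" where "g p = (if p = y then 1 else if p = z then 3 else if p = x then 5
    else if p = w then 7 else if (x, p) \<in> r then 6 else if (z, p) \<in> r then 4 else 2)" for p
  define h :: "'a \<Rightarrow> nat" where "h p = (if p = z then 1 else if p = x then 3 else if p = w then 6
    else if p = y then (if (y, w) \<in> r then 5 else 7)
    else if (x, p) \<in> r then 4 else 2)" for p
  \<comment> \<open>The traces \<open>{v \<in> {x, y, z}. v < q}\<close> occurring in \<open>A\<close>, \<open>B\<close>, \<open>C\<close> are
    \<open>{} \<subset> {x} \<subset> {x, y}\<close>, \<open>{y} \<subset> {y, z} \<subset> {x, y, z}\<close>, \<open>{z} \<subset> {x, z}\<close>. The element \<open>z\<close> is free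
    at the top of \<open>A\<close>, and \<open>y\<close> at the top of \<open>C\<close>, so they can be placed above \<open>w\<close>.\<close>
  define A where "A = {p \<in> P. p \<in> ?X \<or> (z, p) \<notin> r \<and> ((y, p) \<in> r \<longrightarrow> (x, p) \<in> r)}"
  define B where "B = {p \<in> P. p \<in> ?X \<or> (y, p) \<in> r \<and> ((x, p) \<in> r \<longrightarrow> (z, p) \<in> r)}"
  define C where "C = {p \<in> P. p \<in> ?X \<or> (z, p) \<in> r \<and> (y, p) \<notin> r}"
  let ?F = "[(P, d), (A, f), (B, g), (C, h)]"
  have vals: "d x = 0" "d y = 1" "d z = 2" "d w = 4" "f x = 1" "f y = 3" "f w = 6"
    "f z = (if (z, w) \<in> r then 5 else 7)" "g y = 1" "g z = 3" "g x = 5" "g w = 7"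
    "h z = 1" "h x = 3" "h w = 6" "h y = (if (y, w) \<in> r then 5 else 7)"
    using dist unfolding d_def f_def g_def h_def by auto
  have d: "rank_mono r P d"
  proof (rule rank_monoI)
    fix a b assume ab: "a \<in> P" "b \<in> P" "(a, b) \<in> r" "a \<noteq> b"
    then show "d a \<le> d b"
      using not_below[OF ab(3,4)] trans_ab[OF ab(3)] dist by (auto simp: d_def)
  qed
  have f: "rank_mono r A f"
  proof (rule rank_monoI)
    fix a b assume ab: "a \<in> A" "b \<in> A" "(a, b) \<in> r" "a \<noteq> b"
    then show "f a \<le> f b"
      using not_below[OF ab(3,4)] trans_ab[OF ab(3)] dist by (auto simp: f_def A_def)
  qed
  have g: "rank_mono r B g"
  proof (rule rank_monoI)
    fix a b assume ab: "a \<in> B" "b \<in> B" "(a, b) \<in> r" "a \<noteq> b"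
    then show "g a \<le> g b"
      using not_below[OF ab(3,4)] trans_ab[OF ab(3)] dist by (auto simp: g_def B_def)
  qed
  have h: "rank_mono r C h"
  proof (rule rank_monoI)
    fix a b assume ab: "a \<in> C" "b \<in> C" "(a, b) \<in> r" "a \<noteq> b"
    then show "h a \<le> h b"
      using not_below[OF ab(3,4)] trans_ab[OF ab(3)] dist by (auto simp: h_def C_def)
  qed
  show ?thesis
  proof (rule ldim_removal[OF fin po ne, of ?F])
    show "S \<subseteq> P \<and> S \<noteq> {} \<and> rank_mono r S k" if "(S, k) \<in> set ?F" for S k
    proof -
      have "A \<subseteq> P" "B \<subseteq> P" "C \<subseteq> P" "x \<in> A" "x \<in> B" "x \<in> C"
        using mem by (auto simp: A_def B_def C_def)
      then show ?thesis using that d f g h mem by auto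
    qed
    show "\<exists>(S, k)\<in>set ?F. a \<in> S \<and> b \<in> S \<and> (k a < k b \<or> (a, b) \<in> r)"
      if ab: "a \<in> P" "b \<in> P" "a \<in> ?X \<or> b \<in> ?X" "a \<noteq> b" "(b, a) \<notin> r" for a b
    proof -
      have "(d a < d b) \<or> (a \<in> A \<and> b \<in> A \<and> f a < f b) \<or> (a \<in> B \<and> b \<in> B \<and> g a < g b)
        \<or> (a \<in> C \<and> b \<in> C \<and> h a < h b) \<or> (a, b) \<in> r"
      proof (cases "a \<in> ?X"; cases "b \<in> ?X")
        assume "a \<in> ?X" "b \<notin> ?X"
        then have "d a < d b" using ab dist by (auto simp: d_def)
        then show ?thesis ..
      next
        assume X: "a \<in> ?X" "b \<in> ?X"
        then have "a \<in> A" "b \<in> A" "a \<in> B" "b \<in> B" "a \<in> C" "b \<in> C"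
          using ab by (auto simp: A_def B_def C_def)
        \<comment> \<open>\<open>d\<close> orders \<open>X\<close> as \<open>x, y, z, w\<close>. For
          the reversals, \<open>g\<close> has \<open>y\<close> and \<open>z\<close> before
          \<open>x\<close>, \<open>h\<close> has \<open>z\<close> before \<open>y\<close>, and
          \<open>f\<close> and \<open>h\<close> put \<open>w\<close> before \<open>z\<close> and
          \<open>y\<close> respectively if these are not below \<open>w\<close>. The pair
          \<open>x\<close>, \<open>w\<close> is in \<open>r\<close>.\<close>
        moreover have "d a < d b \<or> f a < f b \<or> g a < g b \<or> h a < h b \<or> (a, b) \<in> r"
          using X ab(4,5) xw by (elim insertE emptyE) (simp_all add: vals)
        ultimately show ?thesis by blast
      next
        assume X: "a \<notin> ?X" "b \<in> ?X"
        then have "b \<in> A" "b \<in> B" "b \<in> C" "a \<in> A \<or> a \<in> B \<or> a \<in> C"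
          using ab by (auto simp: A_def B_def C_def)
        moreover have "f a < f b" if "a \<in> A"
          using X ab dist that by (auto simp: f_def A_def)
        moreover have "g a < g b" if "a \<in> B"
          using X ab dist that by (auto simp: g_def B_def)
        moreover have "h a < h b" if "a \<in> C"
          using X ab dist that by (auto simp: h_def C_def)
        ultimately show ?thesis by blast
      qed (use ab in simp)
      then show ?thesis using ab by auto
    qed
    show "length (filter (\<lambda>(S, k). q \<in> S) ?F) \<le> 2" if "q \<in> P - ?X" for q
      using that by (auto simp: A_def B_def C_def)
    show "length ?F \<le> ldim (P - ?X) (Restr r (P - ?X)) + 2" using t by simp
  qed
qed

text \<open>As the rest is a chain, the single order \<open>m\<close> puts every element of
  \<open>X\<close> as high as possible relative to it. Outside elements lie only in \<open>d\<close>
  and \<open>m\<close>.\<close>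

lemma ldim_removal_wide_chain:
  assumes chain: "\<forall>a\<in>P - {x, y, z, w}. \<forall>b\<in>P - {x, y, z, w}. (a, b) \<in> r \<or> (b, a) \<in> r"
  shows "ldim P r \<le> ldim (P - {x, y, z, w}) (Restr r (P - {x, y, z, w})) + 2"
proof -
  let ?X = "{x, y, z, w}"
  let ?Q = "P - ?X"
  \<comment> \<open>\<open>e\<close> starts with \<open>x\<close>, has \<open>w\<close> before those
    of \<open>y\<close>, \<open>z\<close> not below it, and puts \<open>z\<close> before
    \<open>y\<close> exactly when only \<open>z\<close> of the two is below \<open>w\<close>. In
    that case \<open>d\<close> puts \<open>y\<close> under \<open>z\<close>, so \<open>d\<close> and
    \<open>e\<close> always order \<open>x, y, z\<close> in opposite ways.\<close>
  define d :: "'a \<Rightarrow> nat" where "d p = (if p = z then 1 else if p = x then 3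
    else if p = y then (if (z, w) \<in> r \<and> (y, w) \<notin> r then 0 else 2)
    else if p = w then 5 else if (p, w) \<in> r then 4 else 6)" for p
  define e :: "'a \<Rightarrow> nat" where "e p = (if p = x then 0 else if p = y then (if (y, w) \<in> r then 1 else 4)
    else if p = z then (if (z, w) \<in> r then 2 else 5) else 3)" for p
  define m where "m p = (if p \<in> ?Q then 2 * up_rank r ?Q p else 2 * down_rank r ?Q p + 1)" for p
  have anti: "(b, a) \<notin> r" if "(a, b) \<in> r" "a \<noteq> b" for a b
    using antisymD[OF partial_order_onD(3)[OF po]] that by blast
  have Q: "?Q \<subseteq> P" "finite ?Q" using fin by auto
  note up_mono = up_rank_mono[OF po Q chain] and down_mono = down_rank_mono[OF po Q chain]
    and up_down = up_rank_le_down_rank[OF po Q chain] and down_less = down_rank_less[OF po Q chain]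
  let ?F = "[(P, d), (P, m), (?X, e)]"
  have vals: "d x = 3" "d y = (if (z, w) \<in> r \<and> (y, w) \<notin> r then 0 else 2)" "d z = 1" "d w = 5"
    "e x = 0" "e y = (if (y, w) \<in> r then 1 else 4)" "e z = (if (z, w) \<in> r then 2 else 5)" "e w = 3"
    using dist unfolding d_def e_def by auto
  have d: "rank_mono r P d"
  proof (rule rank_monoI)
    fix a b assume ab: "a \<in> P" "b \<in> P" "(a, b) \<in> r" "a \<noteq> b"
    then show "d a \<le> d b"
      using not_below[OF ab(3,4)] trans_ab[OF ab(3)] dist by (auto simp: d_def)
  qed
  have e: "rank_mono r ?X e"
  proof (rule rank_monoI)
    fix a b assume ab: "a \<in> ?X" "b \<in> ?X" "(a, b) \<in> r" "a \<noteq> b"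
    then show "e a \<le> e b"
      using not_below[OF ab(3,4)] trans_ab[OF ab(3)] dist by (auto simp: e_def)
  qed
  have m: "rank_mono r P m"
  proof (rule rank_monoI)
    fix a b assume ab: "a \<in> P" "b \<in> P" "(a, b) \<in> r" "a \<noteq> b"
    show "m a \<le> m b"
    proof (cases "b \<in> ?Q")
      case True
      then show ?thesis using up_mono[OF ab(3)] down_less[OF True ab(3)] by (simp add: m_def)
    next
      case False
      then show ?thesis
        using down_mono[OF ab(3)] up_down[OF anti[OF ab(3,4)]] unfolding m_def if_not_P[OF False] by simp
    qed
  qed
  show ?thesis
  proof (rule ldim_removal[OF fin po ne, of ?F])
    show "S \<subseteq> P \<and> S \<noteq> {} \<and> rank_mono r S k" if "(S, k) \<in> set ?F" for S k
      using that d e m mem by auto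
    show "\<exists>(S, k)\<in>set ?F. a \<in> S \<and> b \<in> S \<and> (k a < k b \<or> (a, b) \<in> r)"
      if ab: "a \<in> P" "b \<in> P" "a \<in> ?X \<or> b \<in> ?X" "a \<noteq> b" "(b, a) \<notin> r" for a b
    proof (cases "a \<in> ?Q")
      case True
      then have "m a < m b" using ab up_down[OF ab(5)] by (auto simp: m_def)
      then show ?thesis using ab by auto
    next
      case False
      then have a: "a \<in> ?X" using ab by simp
      have "d a < d b \<or> (b \<in> ?X \<and> e a < e b) \<or> (a, b) \<in> r"
      proof (cases "b \<in> ?X")
        case True
        then have "d a < d b \<or> e a < e b \<or> (a, b) \<in> r"
          using a ab(4,5) xw by (elim insertE emptyE) (simp_all add: vals)
        then show ?thesis using True by blast
      next
        case False
        then have "d b = (if (b, w) \<in> r then 4 else 6)" by (simp add: d_def)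
        then have "d a < d b" using a ab(5) by (elim insertE emptyE) (simp_all add: vals)
        then show ?thesis ..
      qed
      then show ?thesis using a ab by auto
    qed
    show "length (filter (\<lambda>(S, k). q \<in> S) ?F) \<le> 2" if "q \<in> P - ?X" for q
      using that by auto
    have "ldim ?Q (Restr r ?Q) \<ge> 1" by (rule ldim_ge_1[OF Q(2) ne partial_order_on_Restr[OF po Q(1)]])
    then show "length ?F \<le> ldim (P - ?X) (Restr r (P - ?X)) + 2" by simp
  qed
qed

lemma ldim_removal_three_minimal_one_maximal:
  "ldim P r \<le> ldim (P - {x, y, z, w}) (Restr r (P - {x, y, z, w})) + 2"
proof (cases "ldim (P - {x, y, z, w}) (Restr r (P - {x, y, z, w})) \<ge> 2")
  case True
  then show ?thesis by (rule ldim_removal_wide)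
next
  case False
  have Q: "finite (P - {x, y, z, w})" "P - {x, y, z, w} \<subseteq> P" using fin by auto
  show ?thesis
    by (rule ldim_removal_wide_chain)
      (use comparable_if_ldim_le_1[OF Q(1) partial_order_on_Restr[OF po Q(2)]] False in auto)
qed

end

section \<open>Choosing the four elements\<close>

text \<open>Without three-element chains, \<open>x\<close> is minimal and \<open>w\<close> is
  maximal. Two further minimal elements serve as \<open>y\<close> and \<open>z\<close>; they differ
  from \<open>w\<close>, which lies above \<open>x\<close>.\<close>

lemma removable_quadruple_if_three_minimal:
  assumes fin: "finite P" and po: "partial_order_on P r" and card: "card P \<ge> 5"
    and height: "\<And>a b c. strictly_below r a b \<Longrightarrow> \<not> strictly_below r b c"
    and xw: "strictly_below r x w"
    and three: "card {p \<in> P. \<forall>q. \<not> strictly_below r q p} \<ge> 3" (is "card ?M \<ge> 3")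
  shows "\<exists>x\<in>P. \<exists>y\<in>P. \<exists>z\<in>P. \<exists>w\<in>P. distinct [x, y, z, w] \<and>
    ldim P r \<le> ldim (P - {x, y, z, w}) (Restr r (P - {x, y, z, w})) + 2"
proof -
  have P: "x \<in> P" "w \<in> P" using xw po by (auto simp: strictly_below_def order_on_defs)
  have M: "x \<in> ?M" "w \<notin> ?M" using height xw P by blast+
  have "2 \<le> card (?M - {x})" using three M(1) fin by simp
  then obtain T where T: "T \<subseteq> ?M - {x}" "card T = 2" by (meson obtain_subset_with_card_n)
  then obtain y z where "T = {y, z}" "y \<noteq> z" by (meson card_2_iff)
  then have yz: "y \<in> ?M" "z \<in> ?M" "distinct [x, y, z, w]" using T(1) M by auto
  have "card {x, y, z, w} \<le> 4" by (simp add: card_insert_if)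
  then have ne: "P - {x, y, z, w} \<noteq> {}"
    using card card_mono[of "{x, y, z, w}" P] by auto
  have min: "p = u" if "u \<in> ?M" "(p, u) \<in> r" for p u
    using that by (auto simp: strictly_below_def)
  have max: "p = w" if "(w, p) \<in> r" for p
    using that height[OF xw, of p] by (auto simp: strictly_below_def)
  have "y \<in> P" "z \<in> P" "(x, w) \<in> r" using yz xw by (auto simp: strictly_below_def)
  note ldim_removal_three_minimal_one_maximal[OF fin po P(1) this(1,2) P(2) yz(3)
      min[OF M(1)] min[OF yz(1)] min[OF yz(2)] max this(3) ne]
  then show ?thesis using P \<open>y \<in> P\<close> \<open>z \<in> P\<close> yz(3) by blast
qed

theorem theorem8:
  fixes P :: "'a set" and r :: "'a rel"
  assumes "finite P"
    and "partial_order_on P r"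
    and "card P \<ge> 5"
  shows "\<exists>x\<in>P. \<exists>y\<in>P. \<exists>z\<in>P. \<exists>w\<in>P. distinct [x, y, z, w] \<and>
    ldim P r \<le> ldim (P - {x, y, z, w}) (Restr r (P - {x, y, z, w})) + 2"
proof -
  note fin = assms(1) and po = assms(2)
  have ne: "P - {x, y, z, w} \<noteq> {}" for x y z w
  proof -
    have "card {x, y, z, w} \<le> 4" by (simp add: card_insert_if)
    then show ?thesis using assms(3) card_mono[of "{x, y, z, w}" P] by auto
  qed
  consider (chain) a b c where "strictly_below r a b" "strictly_below r b c"
    | (antichain) "\<And>a b. \<not> strictly_below r a b"
    | (bipartite) x w where "strictly_below r x w"
        "\<And>a b c. strictly_below r a b \<Longrightarrow> \<not> strictly_below r b c"
    by blast
  then show ?thesis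
  proof cases
    case chain
    then have abc: "(a, b) \<in> r" "(b, c) \<in> r" "(a, c) \<in> r" "a \<noteq> b" "b \<noteq> c" "a \<noteq> c"
      using po unfolding strictly_below_def order_on_defs by (blast dest: transD antisymD)+
    then have P: "a \<in> P" "b \<in> P" "c \<in> P" using po by (auto simp: order_on_defs)
    let ?C = "{a, b, c}"
    obtain h :: "'a \<Rightarrow> nat" where h: "\<And>u v. strictly_below r u v \<Longrightarrow> h u < h v"
      using linear_extension_exists[OF fin po] by blast
    \<comment> \<open>The first element outside the chain in a linear extension has only chain
      members strictly below it. The repeated \<open>a\<close> turns the four-element statement
      \<open>ne\<close> into one about three elements.\<close>
    obtain x where x: "x \<in> P - ?C" "\<And>p. p \<in> P - ?C \<Longrightarrow> h x \<le> h p"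
      using ne[of a a b c] ex_has_least_nat[of "\<lambda>p. p \<in> P - ?C" _ h] by auto
    have min: "p \<in> insert x ?C" if "(p, x) \<in> r" for p
    proof (rule ccontr)
      assume p: "p \<notin> insert x ?C"
      moreover have "p \<in> P" using that po by (auto simp: order_on_defs)
      ultimately have "h x \<le> h p" using x(2) by blast
      moreover have "h p < h x" using h that p by (simp add: strictly_below_def)
      ultimately show False by simp
    qed
    have C: "\<forall>u\<in>?C. \<forall>v\<in>?C. (u, v) \<in> r \<or> (v, u) \<in> r"
      using abc P refl_onD[OF partial_order_onD(1)[OF po]] by blast
    have "?C \<subseteq> P" "finite ?C" "x \<in> P" "x \<notin> ?C" using P x(1) by auto
    note ldim_removal_chain_and_point[OF po this(1,2) C fin this(3,4) min ne]
    then show ?thesis using P abc x(1) by (intro bexI[of _ x] bexI[of _ a] bexI[of _ b] bexI[of _ c]) auto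
  next
    case antichain
    obtain T where T: "T \<subseteq> P" "card T = Suc (Suc (Suc (Suc 0)))"
      using assms(3) obtain_subset_with_card_n[of "Suc (Suc (Suc (Suc 0)))" P] by auto
    then obtain x y z w where xyzw: "T = {x, y, z, w}" "distinct [x, y, z, w]"
      by (auto simp: card_Suc_eq)
    have "u = v" if "(u, v) \<in> r" for u v
      using antichain that by (auto simp: strictly_below_def)
    note ldim_removal_antichain[OF fin po ne[of x y z w] this]
    moreover have "x \<in> P" "y \<in> P" "z \<in> P" "w \<in> P" using T(1) xyzw(1) by auto
    ultimately show ?thesis using xyzw(2) by blast
  next
    case bipartite
    define M where "M = {p \<in> P. \<forall>q. \<not> strictly_below r q p}"
    define N where "N = {p \<in> P. \<forall>q. \<not> strictly_below r p q}"
    \<comment> \<open>An element neither minimal nor maximal would be the middle of a three-element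
      chain. Among at least five elements, three are therefore minimal or three are maximal.\<close>
    have "P = M \<union> N" using bipartite(2) by (auto simp: M_def N_def)
    then have "card M + card N \<ge> 5" using assms(3) card_Un_le[of M N] by simp
    then consider "card M \<ge> 3" | "card N \<ge> 3" by linarith
    then show ?thesis
    proof cases
      case 1
      then show ?thesis
        using removable_quadruple_if_three_minimal[OF fin po assms(3) bipartite(2,1)]
        by (simp add: M_def)
    next
      case 2
      \<comment> \<open>In the dual poset the elements of \<open>N\<close> are the minimal ones and
        \<open>w\<close> lies below \<open>x\<close>; local dimensions agree on both sides.\<close>
      have sb: "strictly_below (r\<inverse>) u v \<longleftrightarrow> strictly_below r v u" for u v
        by (auto simp: strictly_below_def)
      have "partial_order_on P (r\<inverse>)" using po by simp
      moreover have "\<not> strictly_below (r\<inverse>) v u" if "strictly_below (r\<inverse>) s v" for s u v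
        using that bipartite(2) sb by blast
      moreover have "strictly_below (r\<inverse>) w x" using bipartite(1) sb by blast
      moreover have "card {p \<in> P. \<forall>q. \<not> strictly_below (r\<inverse>) q p} \<ge> 3"
        using 2 by (simp add: N_def sb)
      ultimately obtain x y z w where xyzw: "x \<in> P" "y \<in> P" "z \<in> P" "w \<in> P" "distinct [x, y, z, w]"
        "ldim P (r\<inverse>) \<le> ldim (P - {x, y, z, w}) (Restr (r\<inverse>) (P - {x, y, z, w})) + 2"
        using removable_quadruple_if_three_minimal[OF fin _ assms(3), of "r\<inverse>" w x] by blast
      let ?Q = "P - {x, y, z, w}"
      have Q: "finite ?Q" "?Q \<subseteq> P" using fin by auto
      have "Restr (r\<inverse>) ?Q = (Restr r ?Q)\<inverse>" by auto
      then have "ldim ?Q (Restr (r\<inverse>) ?Q) = ldim ?Q (Restr r ?Q)"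
        using ldim_converse[OF Q(1) ne partial_order_on_Restr[OF po Q(2)]] by simp
      moreover have "ldim P (r\<inverse>) = ldim P r"
        using ldim_converse[OF fin _ po] ne by blast
      ultimately have "ldim P r \<le> ldim ?Q (Restr r ?Q) + 2" using xyzw(6) by simp
      then show ?thesis using xyzw(1-5) by blast
    qed
  qed
qed

end
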